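(* Let $p=\sum_{i=0}^{d}a_{i}x^{i}\in\mathcal{D}^{+}(\mathbb{R})\setminus\mathbb{R}^{+}[x]$ be a monic squarefree polynomial with $d=\deg(p)$ and $p(0)\neq0$. Let $\Delta$ be the discriminant and $M$ the Mahler measure of $p$, and let $L$ be an upper bound for the magnitude of any (complex) root of $p$. Then $$\deg_{+}(p)\leq\Big\lfloor\frac{d}{2}\Big\rfloor\left(\left\lceil\frac{\pi}{\arcsin\Big(\frac{1}{K^{d-1}}\sqrt{\frac{|\Delta|}{d^{d+3}}}\Big)}\right\rceil-2\right)+d$$ for each $K\in\{M,L^{d/2}\}$.
   Context: $\mathbb{R}^{+}[x]$ is the set of real polynomials with all coefficients non-negative. $\mathcal{D}^{+}(\mathbb{R})=\{0\}\cup\{f\in\mathbb{R}[x] : f(a)>0 \text{ for all } a\in(0,\infty)\}$. For $0\neq p\in\mathbb{R}[x]$, $\deg_{+}(p)$ is the least possible degree of a non-zero polynomial in $\mathbb{R}^{+}[x]$ divisible by $p$ (and $\infty$ if none exists). For a monic polynomial $p=\prod_{i=1}^{d}(x-\alpha_{i})$ with $\alpha_{i}\in\mathbb{C}$, the discriminant is $\Delta=\prod_{1\leq i<j\leq d}(\alpha_{i}-\alpha_{j})^{2}$ and the Mahler measure is $M=\prod_{i=1}^{d}\max\{1,|\alpha_{i}|\}$. *)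

theory Defs
  imports
    "Berlekamp_Zassenhaus.Mahler_Measure"
    "HOL-Library.Extended_Real"
    "HOL-Computational_Algebra.Squarefree"
begin

definition nonneg_polys :: "real poly set"
  where "nonneg_polys = {f. \<forall>i. coeff f i \<ge> 0}"

definition pos_polys :: "real poly set"
  where "pos_polys = {0} \<union> {f. \<forall>a\<in>{0<..}. poly f a > 0}"

text \<open>The infimum of the empty set in \<^typ>\<open>enat\<close> is \<open>\<infinity>\<close>, and a nonempty infimum is attained.\<close>

definition deg_plus :: "real poly \<Rightarrow> enat"
  where "deg_plus p = (INF f\<in>{f \<in> nonneg_polys. f \<noteq> 0 \<and> p dvd f}. enat (degree f))"

text \<open>
  Meant for monic polynomials only: there is no factor for the leading coefficient.
  The list \<^term>\<open>complex_roots_complex p\<close> contains the roots with multiplicity in some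
  unspecified order, on which the product does not depend because of the squares.
\<close>

definition monic_discriminant :: "complex poly \<Rightarrow> complex"
  where "monic_discriminant p =
    (let \<alpha> = complex_roots_complex p
     in \<Prod>(i, j)\<in>{(i, j). i < j \<and> j < length \<alpha>}. (\<alpha> ! i - \<alpha> ! j)\<^sup>2)"

end

theory Submission
  imports Defs "Jordan_Normal_Form.Schur_Decomposition"
begin

text \<open>
  Factor \<open>p\<close> over the reals. Linear factors have non-negative coefficients, because \<open>p\<close> has no
  positive root. A quadratic factor whose root \<open>z\<close> in the upper half plane has argument at least
  \<open>pi / N\<close> divides a polynomial with non-negative coefficients of degree at most \<open>N\<close>: if \<open>m\<close> is the
  least number with \<open>m Arg z \<ge> pi\<close>, eliminating between \<open>z ^ m\<close>, \<open>z\<close> and \<open>1\<close> gives a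
  trinomial with non-negative coefficients. There are at most \<open>d div 2\<close> such factors and each
  raises the degree by at most \<open>N - 2\<close>.

  The lower bound for \<open>sin (Arg z)\<close> is a variant of Mahler's root separation theorem: the square
  root of \<open>\<bar>\<Delta>\<bar>\<close> is the modulus of the Vandermonde determinant of the roots, which Hadamard's
  inequality bounds after a multiple of \<open>sin (Arg z)\<close> has been extracted from the difference of
  the rows of \<open>z\<close> and its conjugate. Dividing all roots by \<open>L\<close> first gives the bound with
  \<open>K = L powr (d / 2)\<close>.
\<close>

subsection \<open>Hadamard's inequality\<close>

text \<open>Schur decomposition makes \<open>A\<close> similar to an upper triangular matrix with
  diagonal \<open>es\<close>, and trace and determinant are similarity invariants. For the trace
  this is the cyclic rearrangement of tr(PTQ) into tr(TQP) with QP = 1.\<close>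

lemma char_poly_roots_sum_diag:
  fixes A :: "complex mat"
  assumes A: "A \<in> carrier_mat n n"
    and es: "char_poly A = (\<Prod>e\<leftarrow>es. [:- e, 1:])"
  shows "sum_list es = (\<Sum>i<n. A $$ (i, i))" and "prod_list es = det A"
proof -
  obtain T P Q where "schur_decomposition A es = (T, P, Q)"
    by (cases "schur_decomposition A es") auto
  from schur_decomposition[OF A es this]
  have wit: "similar_mat_wit A T P Q" and ut: "upper_triangular T" and d: "diag_mat T = es"
    by auto
  note w = similar_mat_witD2[OF A wit]
  have T: "T \<in> carrier_mat n n" and P: "P \<in> carrier_mat n n" and Q: "Q \<in> carrier_mat n n"
    using w by auto
  have QP: "(\<Sum>i<n. Q $$ (k, i) * P $$ (i, j)) = (if k = j then 1 else 0)" if "k < n" "j < n" for k j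
  proof -
    have "(Q * P) $$ (k, j) = (1\<^sub>m n) $$ (k, j)"
      using w by simp
    then show ?thesis
      using that P Q by (simp add: scalar_prod_def atLeast0LessThan)
  qed
  have Aii: "A $$ (i, i) = (\<Sum>k<n. \<Sum>j<n. P $$ (i, j) * T $$ (j, k) * Q $$ (k, i))" if "i < n" for i
  proof -
    have "A = P * T * Q"
      using w by simp
    then have "A $$ (i, i) = (\<Sum>j<n. \<Sum>k<n. P $$ (i, j) * T $$ (j, k) * Q $$ (k, i))"
      using that P Q T by (simp add: scalar_prod_def atLeast0LessThan sum_distrib_left mult_ac)
    also have "\<dots> = (\<Sum>k<n. \<Sum>j<n. P $$ (i, j) * T $$ (j, k) * Q $$ (k, i))"
      by (rule sum.swap)
    finally show ?thesis .
  qed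
  have "(\<Sum>i<n. A $$ (i, i)) = (\<Sum>i<n. \<Sum>k<n. \<Sum>j<n. P $$ (i, j) * T $$ (j, k) * Q $$ (k, i))"
    by (simp add: Aii)
  also have "\<dots> = (\<Sum>k<n. \<Sum>j<n. \<Sum>i<n. P $$ (i, j) * T $$ (j, k) * Q $$ (k, i))"
    by (subst sum.swap, rule sum.cong[OF refl], rule sum.swap)
  also have "\<dots> = (\<Sum>k<n. \<Sum>j<n. T $$ (j, k) * (\<Sum>i<n. Q $$ (k, i) * P $$ (i, j)))"
    by (simp add: sum_distrib_left mult_ac)
  also have "\<dots> = (\<Sum>k<n. \<Sum>j<n. if k = j then T $$ (k, k) else 0)"
    by (intro sum.cong refl) (auto simp: QP)
  also have "\<dots> = (\<Sum>k<n. T $$ (k, k))"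
    by simp
  also have "\<dots> = sum_list es"
    using T by (simp flip: d add: diag_mat_def interv_sum_list_conv_sum_set_nat atLeast0LessThan)
  finally show "sum_list es = (\<Sum>i<n. A $$ (i, i))" ..
  have "det A = det T"
    using wit by (intro det_similar) (auto simp: similar_mat_def)
  also have "\<dots> = prod_list es"
    using det_upper_triangular[OF ut T] d by simp
  finally show "prod_list es = det A" ..
qed

lemma det_gram_mat:
  fixes A :: "complex mat"
  assumes A: "A \<in> carrier_mat n n"
  shows "det (A * transpose_mat (map_mat cnj A)) = complex_of_real ((cmod (det A))\<^sup>2)"
proof -
  interpret cnj_hom: comm_ring_hom cnj
    by unfold_locales auto
  have "det (A * transpose_mat (map_mat cnj A)) = det A * cnj (det A)"
    using A by (simp add: det_mult[where n = n] det_transpose[where n = n])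
  then show ?thesis
    by (simp add: complex_norm_square del: of_real_power)
qed

text \<open>For an eigenvector \<open>v\<close>, the number \<open>e * \<parallel>v\<parallel>\<^sup>2\<close> is the squared norm of the adjoint of \<open>A\<close> applied to \<open>v\<close>.\<close>

lemma gram_eigenvalue_nonneg:
  fixes A :: "complex mat"
  assumes A: "A \<in> carrier_mat n n"
    and ev: "eigenvalue (A * transpose_mat (map_mat cnj A)) e"
  shows "Im e = 0" and "Re e \<ge> 0"
proof -
  obtain v where v: "v \<in> carrier_vec n" "v \<noteq> 0\<^sub>v n"
    and eq: "(A * transpose_mat (map_mat cnj A)) *\<^sub>v v = e \<cdot>\<^sub>v v"
    using ev A by (auto simp: eigenvalue_def eigenvector_def)
  define w where "w k = (\<Sum>j<n. cnj (A $$ (j, k)) * v $ j)" for k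
  define a where "a = (\<Sum>i<n. (cmod (v $ i))\<^sup>2)"
  define b where "b = (\<Sum>k<n. (cmod (w k))\<^sup>2)"
  have comp: "(\<Sum>k<n. A $$ (i, k) * w k) = e * v $ i" if "i < n" for i
  proof -
    have "(A *\<^sub>v (transpose_mat (map_mat cnj A) *\<^sub>v v)) $ i = (e \<cdot>\<^sub>v v) $ i"
      using eq A v by (subst (asm) assoc_mult_mat_vec) auto
    then show ?thesis
      using A v that by (simp add: scalar_prod_def atLeast0LessThan w_def)
  qed
  have "e * complex_of_real a = (\<Sum>i<n. (e * v $ i) * cnj (v $ i))"
    by (simp add: a_def complex_norm_square sum_distrib_left mult_ac del: of_real_power)
  also have "\<dots> = (\<Sum>i<n. \<Sum>k<n. A $$ (i, k) * w k * cnj (v $ i))"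
    by (simp flip: comp add: sum_distrib_right)
  also have "\<dots> = (\<Sum>k<n. w k * (\<Sum>i<n. A $$ (i, k) * cnj (v $ i)))"
    by (subst sum.swap) (simp add: sum_distrib_left mult_ac)
  also have "\<dots> = (\<Sum>k<n. w k * cnj (w k))"
    by (simp add: w_def)
  also have "\<dots> = complex_of_real b"
    by (simp add: b_def complex_norm_square del: of_real_power)
  finally have "e * complex_of_real a = complex_of_real b" .
  moreover have "a > 0"
  proof -
    have "\<exists>i<n. v $ i \<noteq> 0"
      using v by (metis eq_vecI carrier_vecD index_zero_vec(1,2))
    then show ?thesis
      unfolding a_def by (auto intro!: sum_pos2)
  qed
  ultimately have "e = complex_of_real (b / a)"
    by (simp add: field_simps)
  moreover have "b \<ge> 0"
    by (simp add: b_def sum_nonneg)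
  ultimately show "Im e = 0" "Re e \<ge> 0"
    using \<open>a > 0\<close> by auto
qed

text \<open>
  For the eigenvalues of a Gram matrix of unit vectors the exponent is \<open>trace - n = 0\<close>,
  which replaces the inequality of arithmetic and geometric means.
\<close>

lemma prod_list_le_exp_sum:
  assumes "\<And>x. x \<in> set xs \<Longrightarrow> x \<ge> (0::real)"
  shows "prod_list xs \<le> exp (sum_list xs - real (length xs))"
  using assms
proof (induction xs)
  case (Cons x xs)
  have "x * prod_list xs \<le> exp (x - 1) * exp (sum_list xs - real (length xs))"
    using Cons exp_ge_add_one_self[of "x - 1"] by (intro mult_mono prod_list_nonneg) auto
  then show ?case
    by (simp add: algebra_simps flip: exp_add)
qed simp

text \<open>The Gram matrix of unit rows has ones on its diagonal, so its eigenvalues are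
  non-negative reals with sum \<open>n\<close>; their product is the squared modulus of
  \<open>det A\<close>.\<close>

lemma det_unit_rows_le_1:
  fixes A :: "complex mat"
  assumes A: "A \<in> carrier_mat n n"
    and unit: "\<And>i. i < n \<Longrightarrow> (\<Sum>j<n. (cmod (A $$ (i, j)))\<^sup>2) = 1"
  shows "cmod (det A) \<le> 1"
proof -
  define B where "B = A * transpose_mat (map_mat cnj A)"
  have B: "B \<in> carrier_mat n n"
    using A by (simp add: B_def)
  obtain es where es: "char_poly B = (\<Prod>e\<leftarrow>es. [:- e, 1:])" "length es = n"
    using char_poly_factorized[OF B] by auto
  have ge: "Im e = 0 \<and> Re e \<ge> 0" if "e \<in> set es" for e
  proof -
    have "poly (char_poly B) e = 0"
      using that unfolding es(1) by (auto simp: poly_prod_list prod_list_zero_iff image_iff)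
    then have "eigenvalue B e"
      using eigenvalue_root_char_poly[OF B] by simp
    then show ?thesis
      using gram_eigenvalue_nonneg[OF A] unfolding B_def by blast
  qed
  have es_eq: "es = map complex_of_real (map Re es)"
    using ge by (induction es) (auto simp: complex_eq_iff)
  have "complex_of_real (sum_list (map Re es)) = sum_list es"
    by (subst (2) es_eq) (induction es, auto)
  also have "\<dots> = (\<Sum>i<n. B $$ (i, i))"
    using char_poly_roots_sum_diag(1)[OF B es(1)] .
  also have "\<dots> = (\<Sum>i<n. complex_of_real (\<Sum>j<n. (cmod (A $$ (i, j)))\<^sup>2))"
    using A by (simp add: B_def scalar_prod_def complex_norm_square atLeast0LessThan del: of_real_power)
  also have "\<dots> = (\<Sum>i<n. complex_of_real 1)"
    by (intro sum.cong refl arg_cong[where f = complex_of_real] unit) auto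
  also have "\<dots> = complex_of_real n"
    by simp
  finally have sum: "sum_list (map Re es) = n"
    using of_real_eq_iff by blast
  have "complex_of_real (prod_list (map Re es)) = prod_list es"
    by (subst (2) es_eq) (induction es, auto)
  also have "\<dots> = det B"
    using char_poly_roots_sum_diag(2)[OF B es(1)] .
  also have "\<dots> = complex_of_real ((cmod (det A))\<^sup>2)"
    unfolding B_def by (rule det_gram_mat[OF A])
  finally have "(cmod (det A))\<^sup>2 = prod_list (map Re es)"
    using of_real_eq_iff by metis
  also have "\<dots> \<le> exp (sum_list (map Re es) - real (length (map Re es)))"
    using ge by (intro prod_list_le_exp_sum) auto
  also have "\<dots> = 1"
    by (simp only: sum) (simp add: es)
  finally show ?thesis
    by (simp add: power_le_one_iff abs_square_le_1)
qed

lemma det_scale_rows: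
  fixes A :: "'a :: comm_ring_1 mat"
  assumes "A \<in> carrier_mat n n"
  shows "det (mat n n (\<lambda>(i, j). c i * A $$ (i, j))) = (\<Prod>i<n. c i) * det A"
proof -
  have "(\<Prod>i<n. mat n n (\<lambda>(i, j). c i * A $$ (i, j)) $$ (i, p i)) = (\<Prod>i<n. c i) * (\<Prod>i<n. A $$ (i, p i))"
    if "p permutes {..<n}" for p
    using permutes_in_image[OF that] by (simp add: prod.distrib)
  with assms show ?thesis
    by (simp add: det_def'[where n = n] sum_distrib_left mult_ac atLeast0LessThan)
qed

theorem hadamard_det_inequality:
  fixes A :: "complex mat"
  assumes A: "A \<in> carrier_mat n n"
  shows "cmod (det A) \<le> (\<Prod>i<n. sqrt (\<Sum>j<n. (cmod (A $$ (i, j)))\<^sup>2))"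
proof -
  define c where "c i = sqrt (\<Sum>j<n. (cmod (A $$ (i, j)))\<^sup>2)" for i
  \<comment> \<open>Zero rows stay zero, so that scaling each row \<open>i\<close> of
    \<open>U\<close> by \<open>c i\<close> recovers \<open>A\<close> in every case.\<close>
  define U where "U = mat n n (\<lambda>(i, j). if c i = 0 then 0 else A $$ (i, j) / complex_of_real (c i))"
  have U: "U \<in> carrier_mat n n"
    by (simp add: U_def)
  have zero: "A $$ (i, j) = 0" if "c i = 0" "i < n" "j < n" for i j
    using that by (auto simp: c_def sum_nonneg_eq_0_iff)
  have "A = mat n n (\<lambda>(i, j). complex_of_real (c i) * U $$ (i, j))"
    using A zero by (intro eq_matI) (auto simp: U_def)
  then have det: "det A = (\<Prod>i<n. complex_of_real (c i)) * det U"
    using det_scale_rows[OF U, of "\<lambda>i. complex_of_real (c i)"] by metis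
  have c_nonneg: "c i \<ge> 0" for i
    by (simp add: c_def sum_nonneg)
  have "cmod (det A) \<le> (\<Prod>i<n. c i)"
  proof (cases "\<exists>i<n. c i = 0")
    case True
    then have "(\<Prod>i<n. complex_of_real (c i)) = 0"
      by auto
    then show ?thesis
      unfolding det by (simp only: mult_zero_left norm_zero) (simp add: c_nonneg prod_nonneg)
  next
    case False
    have "(\<Sum>j<n. (cmod (U $$ (i, j)))\<^sup>2) = 1" if "i < n" for i
    proof -
      have "(\<Sum>j<n. (cmod (U $$ (i, j)))\<^sup>2) = (\<Sum>j<n. (cmod (A $$ (i, j)))\<^sup>2) / (c i)\<^sup>2"
        using that False by (simp add: U_def norm_divide power_divide sum_divide_distrib)
      also have "(\<Sum>j<n. (cmod (A $$ (i, j)))\<^sup>2) = (c i)\<^sup>2"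
        by (simp add: c_def sum_nonneg)
      finally show ?thesis
        using that False by simp
    qed
    then have "cmod (det U) \<le> 1"
      by (rule det_unit_rows_le_1[OF U])
    moreover have "cmod (\<Prod>i<n. complex_of_real (c i)) = (\<Prod>i<n. c i)"
      unfolding prod_norm[symmetric] by (intro prod.cong refl) (simp add: c_nonneg)
    ultimately show ?thesis
      unfolding det norm_mult by (simp add: c_nonneg prod_nonneg mult_left_le)
  qed
  then show ?thesis
    by (simp add: c_def)
qed

subsection \<open>Vandermonde determinants and root separation\<close>

definition vandermonde_mat :: "nat \<Rightarrow> (nat \<Rightarrow> 'a :: comm_ring_1) \<Rightarrow> 'a mat"
  where "vandermonde_mat n a = mat n n (\<lambda>(i, j). a i ^ j)"

lemma vandermonde_mat_carrier [simp]: "vandermonde_mat n a \<in> carrier_mat n n"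
  by (simp add: vandermonde_mat_def)

text \<open>
  Multiplying by the unitriangular matrix of coefficients of the Newton polynomials
  makes the Vandermonde matrix lower triangular.
\<close>

lemma det_vandermonde_mat:
  fixes a :: "nat \<Rightarrow> 'a :: idom"
  shows "det (vandermonde_mat n a) = (\<Prod>k<n. \<Prod>l<k. a k - a l)"
proof -
  define N where "N k = (\<Prod>l<k. [:- a l, 1:])" for k
  define C where "C = mat n n (\<lambda>(m, k). coeff (N k) m)"
  have C: "C \<in> carrier_mat n n"
    by (simp add: C_def)
  have deg: "degree (N k) = k" for k
    by (simp add: N_def degree_prod_eq_sum_degree)
  have lc: "coeff (N k) k = 1" for k
    using lead_coeff_prod[of "\<lambda>l. [:- a l, 1:]" "{..<k}"] deg[of k] by (simp add: N_def)
  have "upper_triangular C"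
    using deg by (auto simp: C_def coeff_eq_0)
  then have detC: "det C = 1"
    using det_upper_triangular[OF _ C] C by (simp add: prod_list_diag_prod) (simp add: C_def lc)
  have VC: "(vandermonde_mat n a * C) $$ (i, k) = poly (N k) (a i)" if "i < n" "k < n" for i k
  proof -
    have "poly (N k) (a i) = (\<Sum>m\<le>k. coeff (N k) m * a i ^ m)"
      by (simp add: poly_altdef deg)
    also have "\<dots> = (\<Sum>m<n. coeff (N k) m * a i ^ m)"
      using that deg by (intro sum.mono_neutral_left) (auto simp: coeff_eq_0)
    finally show ?thesis
      using that by (simp add: vandermonde_mat_def C_def scalar_prod_def atLeast0LessThan mult_ac)
  qed
  have car: "vandermonde_mat n a * C \<in> carrier_mat n n"
    using C by (intro mult_carrier_mat) auto
  have "det (vandermonde_mat n a) = det (vandermonde_mat n a * C)"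
    using C by (simp add: det_mult[where n = n] detC)
  \<comment> \<open>Entry \<open>(i, k)\<close> is the value of \<open>N k\<close> at
    \<open>a i\<close>, which vanishes for \<open>i < k\<close>.\<close>
  also have "\<dots> = prod_list (diag_mat (vandermonde_mat n a * C))"
    by (rule det_lower_triangular[OF _ car]) (auto simp: VC N_def poly_prod simp del: index_mult_mat)
  also have "\<dots> = (\<Prod>k<n. poly (N k) (a k))"
    using carrier_matD[OF car] by (simp add: prod_list_diag_prod VC atLeast0LessThan del: index_mult_mat)
  finally show ?thesis
    by (simp add: N_def poly_prod)
qed

text \<open>Multiplying the usual bound m r^(m-1) |x - y| by \<open>r\<close> avoids the exponent m
  - 1 and produces the factor \<open>r\<close> that the sine of an angle requires later.\<close>

lemma norm_power_diff_mult_le: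
  fixes x y :: complex
  assumes "cmod x = r" "cmod y = r"
  shows "r * cmod (x ^ m - y ^ m) \<le> real m * r ^ m * cmod (x - y)"
proof (induction m)
  case (Suc m)
  have r: "r \<ge> 0"
    using assms(1) norm_ge_zero by blast
  have "x ^ Suc m - y ^ Suc m = x * (x ^ m - y ^ m) + (x - y) * y ^ m"
    by (simp add: algebra_simps)
  then have "cmod (x ^ Suc m - y ^ Suc m) \<le> r * cmod (x ^ m - y ^ m) + cmod (x - y) * r ^ m"
    using norm_triangle_ineq[of "x * (x ^ m - y ^ m)" "(x - y) * y ^ m"] assms
    by (simp add: norm_mult norm_power)
  also have "\<dots> \<le> real m * r ^ m * cmod (x - y) + cmod (x - y) * r ^ m"
    using Suc by simp
  finally have "r * cmod (x ^ Suc m - y ^ Suc m) \<le> r * (real m * r ^ m * cmod (x - y) + cmod (x - y) * r ^ m)"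
    using r by (rule mult_left_mono)
  then show ?case
    by (simp add: algebra_simps)
qed simp

lemma sum_squares_le: "(\<Sum>m<n. (real m)\<^sup>2) \<le> real n ^ 3 / 3"
proof (induction n)
  case (Suc n)
  have "real (Suc n) ^ 3 / 3 = real n ^ 3 / 3 + (real n)\<^sup>2 + real n + 1 / 3"
    by (simp add: power3_eq_cube power2_eq_square add_divide_distrib distrib_left distrib_right)
  with Suc show ?case
    unfolding sum.lessThan_Suc by linarith
qed simp

lemma power_le_max_power:
  fixes r :: real
  assumes "r \<ge> 0" "m < n"
  shows "r ^ m \<le> max 1 r ^ (n - 1)"
proof -
  have "r ^ m \<le> max 1 r ^ m"
    using assms by (intro power_mono) auto
  also have "\<dots> \<le> max 1 r ^ (n - 1)"
    using assms by (intro power_increasing) auto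
  finally show ?thesis .
qed

text \<open>
  Mahler's root separation argument: subtracting row \<open>j\<close> from row \<open>i\<close> allows the factor
  \<open>a i - a j\<close> to be extracted before Hadamard's inequality is applied. The additional factor
  \<open>r\<close> on the left makes the estimate bound the sine of the angle between \<open>a i\<close> and \<open>a j\<close>.
\<close>

lemma vandermonde_root_separation:
  fixes a :: "nat \<Rightarrow> complex"
  assumes i: "i < n" and j: "j < n" and neq: "a i \<noteq> a j"
    and r: "cmod (a i) = r" "cmod (a j) = r"
  shows "r * cmod (det (vandermonde_mat n a)) \<le>
    cmod (a i - a j) * sqrt (real n ^ (n + 2) / 3) * (\<Prod>k<n. max 1 (cmod (a k))) ^ (n - 1)"
proof -
  define \<delta> where "\<delta> = a i - a j"
  define V where "V = vandermonde_mat n a"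
  \<comment> \<open>\<open>W\<close> arises from the Vandermonde matrix by subtracting row
    \<open>j\<close> from row \<open>i\<close> and then scaling row \<open>i\<close> by r /
    \<delta>.\<close>
  define W where "W = mat n n (\<lambda>(k, m).
    if k = i then complex_of_real r * (a i ^ m - a j ^ m) / \<delta> else a k ^ m)"
  \<comment> \<open>These bound the row norms of \<open>W\<close>: entry \<open>m\<close> of row
    \<open>i\<close> costs an extra factor \<open>m\<close>, and the squares of these factors sum to
    at most \<open>n ^ 3 / 3\<close>; every other row has \<open>n\<close> entries bounded by the
    power of the maximum.\<close>
  define B where "B k = max 1 (cmod (a k)) ^ (n - 1) * (if k = i then sqrt (real n ^ 3 / 3) else sqrt (real n))" for k
  have \<delta>: "\<delta> \<noteq> 0"
    using neq by (simp add: \<delta>_def)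
  have ij: "i \<noteq> j"
    using neq by auto
  have V: "V \<in> carrier_mat n n" and W: "W \<in> carrier_mat n n"
    by (simp_all add: V_def W_def)
  have r0: "r \<ge> 0"
    using r(1) norm_ge_zero by blast
  have "multrow i \<delta> W = multrow i (complex_of_real r) (addrow (- 1) i j V)"
    using i j ij \<delta> by (intro eq_matI) (auto simp: W_def V_def vandermonde_mat_def algebra_simps)
  then have "det (multrow i \<delta> W) = det (multrow i (complex_of_real r) (addrow (- 1) i j V))"
    by simp
  then have "\<delta> * det W = complex_of_real r * det V"
    using i j ij V W by (simp add: det_multrow[where n = n] det_addrow[where n = n])
  then have "cmod \<delta> * cmod (det W) = r * cmod (det V)"
    using r0 by (metis norm_mult norm_of_real abs_of_nonneg)
  moreover have "cmod (det W) \<le> (\<Prod>k<n. B k)"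
  proof (rule order_trans[OF hadamard_det_inequality[OF W]], rule prod_mono, safe)
    fix k assume k: "k < n"
    let ?w = "max 1 (cmod (a k)) ^ (n - 1)"
    show "0 \<le> sqrt (\<Sum>m<n. (cmod (W $$ (k, m)))\<^sup>2)"
      by (simp add: sum_nonneg)
    show "sqrt (\<Sum>m<n. (cmod (W $$ (k, m)))\<^sup>2) \<le> B k"
    proof (cases "k = i")
      case True
      have "cmod (W $$ (i, m)) \<le> real m * ?w" if "m < n" for m
      proof -
        have "cmod (W $$ (i, m)) = r * cmod (a i ^ m - a j ^ m) / cmod \<delta>"
          using that i r0 by (simp add: W_def norm_mult norm_divide)
        also have "\<dots> \<le> real m * r ^ m"
          using norm_power_diff_mult_le[OF r, of m] \<delta> by (simp add: \<delta>_def field_simps)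
        also have "\<dots> \<le> real m * ?w"
          using power_le_max_power[OF r0 that] r True by (intro mult_left_mono) auto
        finally show ?thesis .
      qed
      then have "(\<Sum>m<n. (cmod (W $$ (k, m)))\<^sup>2) \<le> (\<Sum>m<n. (real m * ?w)\<^sup>2)"
        using True by (intro sum_mono power_mono) auto
      also have "\<dots> = ?w\<^sup>2 * (\<Sum>m<n. (real m)\<^sup>2)"
        unfolding power_mult_distrib sum_distrib_left by (simp add: mult.commute)
      also have "\<dots> \<le> ?w\<^sup>2 * (real n ^ 3 / 3)"
        by (intro mult_left_mono sum_squares_le) auto
      finally have "sqrt (\<Sum>m<n. (cmod (W $$ (k, m)))\<^sup>2) \<le> sqrt (?w\<^sup>2 * (real n ^ 3 / 3))"
        by simp
      also have "\<dots> = B k"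
        using True by (simp add: B_def real_sqrt_mult real_sqrt_abs real_sqrt_divide)
      finally show ?thesis .
    next
      case False
      have "cmod (W $$ (k, m)) \<le> ?w" if "m < n" for m
        using that k False power_le_max_power[of "cmod (a k)" m n] by (simp add: W_def norm_power)
      then have "(\<Sum>m<n. (cmod (W $$ (k, m)))\<^sup>2) \<le> (\<Sum>m<n. ?w\<^sup>2)"
        by (intro sum_mono power_mono) auto
      then have "sqrt (\<Sum>m<n. (cmod (W $$ (k, m)))\<^sup>2) \<le> sqrt (real n * ?w\<^sup>2)"
        by simp
      also have "\<dots> = B k"
        using False by (simp add: B_def real_sqrt_mult real_sqrt_abs real_sqrt_divide)
      finally show ?thesis .
    qed
  qed
  moreover have "(\<Prod>k<n. B k) = sqrt (real n ^ (n + 2) / 3) * (\<Prod>k<n. max 1 (cmod (a k))) ^ (n - 1)"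
  proof -
    have "(\<Prod>k<n. if k = i then sqrt (real n ^ 3 / 3) else sqrt (real n)) =
        sqrt (real n ^ 3 / 3) * (\<Prod>k\<in>{..<n} - {i}. sqrt (real n))"
      using i by (subst prod.remove[of _ i]) auto
    also have "\<dots> = sqrt (real n ^ 3 / 3 * real n ^ (n - 1))"
      using i by (simp add: real_sqrt_mult real_sqrt_divide real_sqrt_power)
    also have "real n ^ 3 / 3 * real n ^ (n - 1) = real n ^ (n + 2) / 3"
      using i by (simp flip: power_add)
    finally show ?thesis
      by (simp add: B_def prod.distrib prod_power_distrib mult_ac)
  qed
  ultimately show ?thesis
    using mult_left_mono[of "cmod (det W)" "\<Prod>k<n. B k" "cmod \<delta>"] by (simp add: V_def \<delta>_def mult_ac)
qed

text \<open>Dividing all the points by \<open>L\<close> makes every factor of the Mahler measure equal to \<open>1\<close>.\<close>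

lemma vandermonde_root_separation_bounded:
  fixes a :: "nat \<Rightarrow> complex"
  assumes i: "i < n" and j: "j < n" and neq: "a i \<noteq> a j"
    and r: "cmod (a i) = r" "cmod (a j) = r"
    and L: "L > 0" "\<And>k. k < n \<Longrightarrow> cmod (a k) \<le> L"
  shows "r * cmod (det (vandermonde_mat n a)) \<le>
    cmod (a i - a j) * sqrt (real n ^ (n + 2) / 3) * (L powr (real n / 2)) ^ (n - 1)"
proof -
  define b where "b k = a k / complex_of_real L" for k
  define S where "S = (L powr (real n / 2)) ^ (n - 1)"
  \<comment> \<open>The Vandermonde determinant is homogeneous of degree 0 + 1 + ... + (n - 1) = n
    (n - 1) / 2, so dividing the points by \<open>L\<close> divides it by \<open>S\<close>.\<close>
  have "2 * (\<Sum>k<m. real k) = real m * (real m - 1)" for m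
    by (induction m) (auto simp: algebra_simps)
  from this[of n] have "real (\<Sum>k<n. k) = real n / 2 * real (n - 1)"
    using i by (simp add: of_nat_diff)
  then have "L ^ (\<Sum>k<n. k) = L powr (real n / 2 * real (n - 1))"
    using L(1) by (metis powr_realpow)
  also have "\<dots> = S"
    using L(1) by (simp add: S_def powr_powr flip: powr_realpow)
  finally have S: "(\<Prod>k<n. L ^ k) = S"
    by (simp add: power_sum)
  have Spos: "S > 0"
    using L(1) by (simp add: S_def)
  have "det (vandermonde_mat n b) = (\<Prod>k<n. (\<Prod>l<k. a k - a l) / complex_of_real (L ^ k))"
    by (simp add: det_vandermonde_mat b_def prod_dividef flip: diff_divide_distrib)
  also have "\<dots> = det (vandermonde_mat n a) / complex_of_real S"
    by (simp add: det_vandermonde_mat prod_dividef flip: S)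
  finally have "cmod (det (vandermonde_mat n b)) = cmod (det (vandermonde_mat n a)) / S"
    using Spos by (simp add: norm_divide)
  moreover have "r / L * cmod (det (vandermonde_mat n b)) \<le>
      cmod (b i - b j) * sqrt (real n ^ (n + 2) / 3) * (\<Prod>k<n. max 1 (cmod (b k))) ^ (n - 1)"
    using i j neq r L(1) by (intro vandermonde_root_separation) (auto simp: b_def norm_divide)
  moreover have "(\<Prod>k<n. max 1 (cmod (b k))) = 1"
    using L by (intro prod.neutral) (auto simp: b_def norm_divide)
  moreover have "cmod (b i - b j) = cmod (a i - a j) / L"
    using L(1) by (simp add: b_def norm_divide flip: diff_divide_distrib)
  ultimately have "r / L * (cmod (det (vandermonde_mat n a)) / S) \<le>
      cmod (a i - a j) / L * sqrt (real n ^ (n + 2) / 3)"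
    by (simp only: power_one mult_1_right)
  then have "r * cmod (det (vandermonde_mat n a)) \<le> cmod (a i - a j) * sqrt (real n ^ (n + 2) / 3) * S"
    using L(1) Spos by (simp add: divide_simps mult_ac)
  then show ?thesis
    by (simp only: S_def)
qed

lemma norm_monic_discriminant:
  "cmod (monic_discriminant p) =
    (cmod (det (vandermonde_mat (degree p) (\<lambda>i. complex_roots_complex p ! i))))\<^sup>2"
proof -
  define a where "a i = complex_roots_complex p ! i" for i
  have "{(i, j). i < j \<and> j < degree p} = (\<lambda>(k, l). (l, k)) ` (SIGMA k:{..<degree p}. {..<k})"
    by (auto simp: image_iff)
  then have "cmod (monic_discriminant p) =
      (\<Prod>(k, l)\<in>(SIGMA k:{..<degree p}. {..<k}). (cmod (a l - a k))\<^sup>2)"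
    by (simp add: monic_discriminant_def Let_def a_def norm_power prod.reindex inj_on_def
        split_def flip: prod_norm)
  also have "\<dots> = (\<Prod>k<degree p. \<Prod>l<k. (cmod (a l - a k))\<^sup>2)"
    by (simp add: prod.Sigma)
  also have "\<dots> = (cmod (det (vandermonde_mat (degree p) a)))\<^sup>2"
    by (simp add: det_vandermonde_mat prod_power_distrib norm_minus_commute flip: prod_norm)
  finally show ?thesis
    by (simp add: a_def[abs_def])
qed

subsection \<open>Multiples with non-negative coefficients\<close>

lemma nonneg_polys_mult: "f \<in> nonneg_polys \<Longrightarrow> g \<in> nonneg_polys \<Longrightarrow> f * g \<in> nonneg_polys"
  by (auto simp: nonneg_polys_def coeff_mult intro!: sum_nonneg)

lemma map_poly_of_real_mult:
  "map_poly complex_of_real (p * q) = map_poly complex_of_real p * map_poly complex_of_real q"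
proof -
  interpret map_poly_inj_idom_hom complex_of_real ..
  show ?thesis
    by (rule hom_mult)
qed

lemma map_poly_of_real_add:
  "map_poly complex_of_real (p + q) = map_poly complex_of_real p + map_poly complex_of_real q"
proof -
  interpret map_poly_inj_idom_hom complex_of_real ..
  show ?thesis
    by (rule hom_add)
qed

text \<open>Expansion of (x - z)(x - cnj z), the real quadratic factor belonging to a pair of
  conjugate roots.\<close>

definition conj_quadratic :: "complex \<Rightarrow> real poly"
  where "conj_quadratic z = [:(cmod z)\<^sup>2, - 2 * Re z, 1:]"

lemma degree_conj_quadratic [simp]: "degree (conj_quadratic z) = 2"
  by (simp add: conj_quadratic_def)

lemma conj_quadratic_nonzero [simp]: "conj_quadratic z \<noteq> 0"
  by (simp add: conj_quadratic_def)

lemma complex_square_eq: "z\<^sup>2 = complex_of_real (2 * Re z) * z - complex_of_real ((cmod z)\<^sup>2)"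
  by (rule complex_eqI) (simp_all add: cmod_power2 Re_power2 Im_power2, simp add: power2_eq_square)

lemma poly_of_real_conj_quadratic: "poly (map_poly complex_of_real (conj_quadratic z)) z = 0"
  using complex_square_eq[of z] by (simp add: conj_quadratic_def power2_eq_square algebra_simps)

text \<open>The remainder on division is real of degree at most 1, and such a polynomial can vanish
  at a non-real point only if it is zero.\<close>

lemma conj_quadratic_dvd:
  assumes root: "poly (map_poly complex_of_real p) z = 0" and Im: "Im z \<noteq> 0"
  shows "conj_quadratic z dvd p"
proof -
  define s where "s = p mod conj_quadratic z"
  have "degree s < 2"
    using degree_mod_less[OF conj_quadratic_nonzero, of p z] by (auto simp: s_def)
  then have s: "s = [:coeff s 0, coeff s 1:]"
    by (intro poly_eqI) (auto simp: coeff_pCons coeff_eq_0 split: nat.splits)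
  have "p = conj_quadratic z * (p div conj_quadratic z) + s"
    by (simp add: s_def)
  then have "poly (map_poly complex_of_real p) z = poly (map_poly complex_of_real s) z"
    by (metis add_0 mult_zero_left map_poly_of_real_add map_poly_of_real_mult
        poly_add poly_mult poly_of_real_conj_quadratic)
  with root have "poly (map_poly complex_of_real s) z = 0"
    by simp
  then have "complex_of_real (coeff s 0) + z * complex_of_real (coeff s 1) = 0"
    by (subst (asm) s) (simp only: of_real_hom.map_poly_pCons_hom map_poly_0 poly_pCons poly_0 mult_zero_right add_0_right)
  then have "coeff s 1 = 0" "coeff s 0 = 0"
    using Im by (auto simp: complex_eq_iff)
  then have "s = 0"
    by (subst s) simp
  then show ?thesis
    by (simp add: s_def mod_eq_0_iff_dvd)
qed

text \<open>Imaginary parts of the powers of \<open>z\<close> satisfy the recurrence z^(n+2) = 2 Re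
  z z^(n+1) - |z|^2 z^n. Hence x times the trinomial for \<open>n\<close> differs from the one for
  \<open>n + 1\<close> by a multiple of the quadratic.\<close>

lemma conj_quadratic_dvd_trinomial:
  "conj_quadratic z dvd
    monom (Im z) (Suc n) + [:(cmod z)\<^sup>2 * Im (z ^ n), - Im (z ^ Suc n):]"
proof (induction n)
  case 0
  have "monom (Im z) (Suc 0) + [:(cmod z)\<^sup>2 * Im (z ^ 0), - Im (z ^ Suc 0):] = 0"
    by (simp add: monom_Suc monom_0)
  then show ?case
    by (metis dvd_0_right)
next
  case (Suc n)
  let ?F = "\<lambda>n. monom (Im z) (Suc n) + [:(cmod z)\<^sup>2 * Im (z ^ n), - Im (z ^ Suc n):]"
  have "z ^ Suc (Suc n) = z\<^sup>2 * z ^ n"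
    by (simp add: power2_eq_square)
  also have "\<dots> = complex_of_real (2 * Re z) * z ^ Suc n - complex_of_real ((cmod z)\<^sup>2) * z ^ n"
    by (subst complex_square_eq) (simp add: algebra_simps)
  finally have "Im (z ^ Suc (Suc n)) = 2 * Re z * Im (z ^ Suc n) - (cmod z)\<^sup>2 * Im (z ^ n)"
    by (simp del: power_Suc)
  then have "?F (Suc n) = [:0, 1:] * ?F n + smult (Im (z ^ Suc n)) (conj_quadratic z)"
    by (simp add: monom_Suc conj_quadratic_def algebra_simps del: power_Suc)
  then show ?case
    using dvd_add[OF dvd_mult[OF Suc] dvd_smult[OF dvd_refl]] by (simp only:)
qed

lemma Im_power_eq_sin: "Im (z ^ n) = cmod z ^ n * sin (real n * Arg z)"
  by (metis DeMoivre2 Im_rcis rcis_cmod_Arg)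

text \<open>
  If \<open>n + 1\<close> is the least multiplier with \<open>(n + 1) Arg z \<ge> pi\<close>, then
  \<open>Im (z ^ n) \<ge> 0 \<ge> Im (z ^ (n + 1))\<close>, so the trinomial above has no negative coefficient.
\<close>

lemma conj_quadratic_nonneg_multiple:
  assumes Im: "Im z > 0" and N: "pi \<le> real N * Arg z"
  obtains f where "f \<in> nonneg_polys" "f \<noteq> 0" "conj_quadratic z dvd f" "degree f \<le> N"
proof -
  define t where "t = Arg z"
  define m where "m = (LEAST m. pi \<le> real m * t)"
  have "sin t > 0"
    using Im by (subst t_def, subst sin_Arg) (auto intro!: divide_pos_pos)
  moreover have "t \<le> pi" "- pi < t"
    using Arg_bounded[of z] by (auto simp: t_def)
  moreover have "t \<noteq> pi"
    using \<open>sin t > 0\<close> by auto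
  ultimately have t: "0 < t" "t < pi"
    using sin_ge_zero[of "- t"] by (cases "0 < t"; simp)+
  have "pi \<le> real N * t"
    using N by (simp add: t_def)
  then have m: "pi \<le> real m * t" "m \<le> N"
    unfolding m_def by (rule LeastI, rule Least_le)
  have "m \<noteq> 0"
  proof
    assume "m = 0"
    then have "real m * t = 0"
      by simp
    with m(1) show False
      using pi_gt_zero by linarith
  qed
  \<comment> \<open>This gives \<open>n >= 1\<close>, so that the leading monomial cannot merge with
    the linear part of the trinomial.\<close>
  moreover have "m \<noteq> 1"
    using m(1) t by auto
  ultimately obtain n where n: "m = Suc n" "n \<ge> 1"
    by (cases m) auto
  have lt: "real n * t < pi"
    using not_less_Least[of n "\<lambda>m. pi \<le> real m * t"] n(1) by (auto simp: m_def)
  have Im_n: "Im (z ^ n) \<ge> 0"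
    unfolding Im_power_eq_sin using lt t by (intro mult_nonneg_nonneg sin_ge_zero) (simp_all flip: t_def)
  have "real m * t = real n * t + t"
    using n by (simp add: algebra_simps)
  then have "sin (real m * t) \<le> 0"
    using lt t m(1) by (intro sin_le_zero) linarith+
  then have Im_m: "Im (z ^ Suc n) \<le> 0"
    unfolding Im_power_eq_sin n(1) t_def by (rule mult_nonneg_nonpos[rotated]) simp
  let ?f = "monom (Im z) (Suc n) + [:(cmod z)\<^sup>2 * Im (z ^ n), - Im (z ^ Suc n):]"
  have "?f \<in> nonneg_polys"
    using Im Im_n Im_m by (auto simp: nonneg_polys_def coeff_pCons simp del: power_Suc split: nat.splits)
  moreover have "coeff ?f (Suc n) = Im z"
    using n by (simp add: coeff_pCons split: nat.splits)
  then have "?f \<noteq> 0"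
    using Im by (metis coeff_0 less_irrefl)
  moreover have "degree ?f \<le> N"
    using m(2) n by (intro degree_add_le) (auto intro: order_trans[OF degree_monom_le] degree_pCons_le)
  ultimately show thesis
    using that conj_quadratic_dvd_trinomial by blast
qed

text \<open>Induction on the degree splits off one linear or conjugate quadratic factor at a time
  and multiplies the non-negative multiples of the factors.\<close>

lemma nonneg_multiple_exists:
  fixes p :: "real poly"
  assumes "p \<noteq> 0" and "N \<ge> 2"
    and "\<And>x. x > 0 \<Longrightarrow> poly p x \<noteq> 0"
    and "\<And>z. poly (map_poly complex_of_real p) z = 0 \<Longrightarrow> Im z > 0 \<Longrightarrow> pi \<le> real N * Arg z"
  shows "\<exists>f\<in>nonneg_polys. f \<noteq> 0 \<and> p dvd f \<and> degree f \<le> degree p + degree p div 2 * (N - 2)"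
  using assms(1,3,4)
proof (induction "degree p" arbitrary: p rule: less_induct)
  case less
  show ?case
  proof (cases "degree p = 0")
    case True
    then have "p dvd 1"
      using less.prems(1) by (simp add: is_unit_iff_degree)
    moreover have "1 \<in> nonneg_polys"
      by (simp add: nonneg_polys_def)
    ultimately show ?thesis
      by (intro bexI[of _ 1]) auto
  next
    case False
    \<comment> \<open>Shared by both kinds of factor. A linear \<open>q\<close> has no room for a
      larger degree and serves as its own \<open>h\<close>; a quadratic one may have
      \<open>h\<close> of degree up to \<open>N\<close>. The bounds combine because a div 2 + b div
      2 <= (a + b) div 2.\<close>
    have ext: ?thesis
      if p: "p = q * g" and q: "degree q > 0" "q dvd h" and h: "h \<in> nonneg_polys" "h \<noteq> 0"
        and deg: "degree h \<le> degree q + degree q div 2 * (N - 2)" for q g h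
    proof -
      have nz: "q \<noteq> 0" "g \<noteq> 0"
        using p less.prems(1) by auto
      then have degp: "degree p = degree q + degree g"
        using p by (simp add: degree_mult_eq)
      then obtain f where f: "f \<in> nonneg_polys" "f \<noteq> 0" "g dvd f"
        "degree f \<le> degree g + degree g div 2 * (N - 2)"
        using less.hyps[of g] less.prems q(1) nz p by (auto simp: map_poly_of_real_mult)
      have "degree (h * f) \<le> degree p + (degree q div 2 + degree g div 2) * (N - 2)"
        using h f deg degp by (simp add: degree_mult_eq algebra_simps)
      also have "\<dots> \<le> degree p + degree p div 2 * (N - 2)"
        unfolding degp by (intro add_left_mono mult_right_mono) auto
      finally show ?thesis
        using h f p q(2) by (intro bexI[of _ "h * f"]) (auto intro: nonneg_polys_mult mult_dvd_mono)
    qed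
    have "degree (map_poly complex_of_real p) \<noteq> 0"
      using False by simp
    then obtain z where z: "poly (map_poly complex_of_real p) z = 0"
      using fundamental_theorem_of_algebra constant_degree by metis
    show ?thesis
    proof (cases "Im z = 0")
      case True
      then have "z = complex_of_real (Re z)"
        by (simp add: complex_eq_iff)
      then have root: "poly p (Re z) = 0"
        using z by (metis of_real_hom.hom_0_iff of_real_hom.poly_map_poly)
      then obtain g where g: "p = [:- Re z, 1:] * g"
        by (auto simp: poly_eq_0_iff_dvd elim: dvdE)
      have "Re z \<le> 0"
        using root less.prems(2) by (meson not_le)
      then have "[:- Re z, 1:] \<in> nonneg_polys"
        by (auto simp: nonneg_polys_def coeff_pCons split: nat.splits)
      then show ?thesis
        by (intro ext[OF g, of "[:- Re z, 1:]"]) auto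
    next
      case False
      define w where "w = (if Im z > 0 then z else cnj z)"
      have w: "poly (map_poly complex_of_real p) w = 0" "Im w > 0"
        using z False by (auto simp: w_def real_poly_cnj_root_iff)
      obtain g where g: "p = conj_quadratic w * g"
        using conj_quadratic_dvd[OF w(1)] w(2) by (auto elim: dvdE)
      obtain h where "h \<in> nonneg_polys" "h \<noteq> 0" "conj_quadratic w dvd h" "degree h \<le> N"
        using conj_quadratic_nonneg_multiple[OF w(2) less.prems(3)[OF w]] .
      then show ?thesis
        using \<open>N \<ge> 2\<close> by (intro ext[OF g, of h]) auto
    qed
  qed
qed

text \<open>A repeated root would be a common zero of the polynomial and its derivative. These are
  coprime over the reals, and their Bezout identity carries over to the complex numbers.\<close>

lemma distinct_complex_roots_of_squarefree:
  fixes p :: "real poly"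
  assumes "squarefree p"
  shows "distinct (complex_roots_complex (map_poly complex_of_real p))"
proof (rule ccontr)
  define P where "P = map_poly complex_of_real p"
  assume "\<not> distinct (complex_roots_complex (map_poly complex_of_real p))"
  then obtain xs ys zs y where "complex_roots_complex P = xs @ [y] @ ys @ [y] @ zs"
    unfolding P_def by (meson not_distinct_decomp)
  note split = this
  define g where "g = smult (lead_coeff P) (\<Prod>a\<leftarrow>xs @ ys @ zs. [:- a, 1:])"
  have g: "P = [:- y, 1:] * [:- y, 1:] * g"
    by (subst complex_roots(1)[symmetric], subst split) (simp only: g_def map_append list.map prod_list.append
      prod_list.Cons prod_list.Nil mult_smult_right mult_smult_left mult_ac mult_1_right mult_1_left)
  have roots: "poly P y = 0" "poly (pderiv P) y = 0"
    unfolding g pderiv_mult by simp_all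
  \<comment> \<open>\<open>squarefree\<close> excludes squares of non-units,
    \<open>square_free\<close> squares of polynomials of positive degree; over a field these agree
    for nonzero \<open>p\<close>.\<close>
  have "square_free p"
    unfolding square_free_def
  proof (intro conjI allI impI notI)
    show False if "p = 0"
      using assms that by simp
    show False if "degree q > 0" "q * q dvd p" for q
      using squarefreeD[OF assms, of q] that by (auto simp: power2_eq_square is_unit_iff_degree)
  qed
  then have "gcd p (pderiv p) = 1"
    using square_free_imp_separable[of p] by (simp add: separable_def)
  then obtain u v where "u * p + v * pderiv p = 1"
    using bezout_coefficients_fst_snd[of p "pderiv p"] by metis
  then have "map_poly complex_of_real u * P + map_poly complex_of_real v * pderiv P = 1"
    unfolding P_def of_real_hom.map_poly_pderiv[symmetric] map_poly_of_real_mult[symmetric]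
      map_poly_of_real_add[symmetric] by simp
  then have "poly (map_poly complex_of_real u * P + map_poly complex_of_real v * pderiv P) y = 1"
    by simp
  with roots show False
    by simp
qed

subsection \<open>Angles of the roots\<close>

lemma poly_eq_0_iff_complex_roots:
  assumes "p \<noteq> 0"
  shows "poly p z = 0 \<longleftrightarrow> z \<in> set (complex_roots_complex p)"
proof -
  have "poly p z = 0 \<longleftrightarrow> poly (smult (lead_coeff p) (\<Prod>a\<leftarrow>complex_roots_complex p. [:- a, 1:])) z = 0"
    by (simp only: complex_roots(1))
  then show ?thesis
    using assms by (auto simp: poly_prod_list prod_list_zero_iff image_iff)
qed

text \<open>For degree reasons the cofactor is a constant, and it is positive because
  \<open>p\<close> is monic.\<close>

lemma nonneg_polys_of_nonneg_multiple:
  assumes lc: "lead_coeff p = 1" and f: "f \<in> nonneg_polys" "f \<noteq> 0" "p dvd f" "degree f \<le> degree p"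
  shows "p \<in> nonneg_polys"
proof -
  obtain c where c: "f = p * c"
    using f(3) by (auto elim: dvdE)
  have "degree c = 0"
    using f(2,4) by (auto simp: c degree_mult_eq)
  then obtain k where k: "c = [:k:]"
    by (auto elim: degree_eq_zeroE)
  have fk: "coeff f i = k * coeff p i" for i
    by (simp add: c k)
  have "k \<ge> 0"
    using f(1) fk[of "degree p"] lc unfolding nonneg_polys_def by (metis (mono_tags) mem_Collect_eq mult_1_right)
  moreover have "k \<noteq> 0"
    using f(2) by (auto simp: c k)
  moreover have "k * coeff p i \<ge> 0" for i
    using f(1) unfolding nonneg_polys_def fk[symmetric] by simp
  ultimately have "coeff p i \<ge> 0" for i
    by (metis le_less zero_le_mult_iff not_less)
  then show ?thesis
    by (simp add: nonneg_polys_def)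
qed

text \<open>Below \<open>pi / 2\<close> arcsine inverts the sine of the argument; from there on the
  claim is clear because arcsine never exceeds \<open>pi / 2\<close>.\<close>

lemma Arg_ge_arcsin:
  assumes Im: "Im z > 0" and s: "0 \<le> s" "s \<le> 1" and le: "s * cmod z \<le> Im z"
  shows "arcsin s \<le> Arg z"
proof (cases "Arg z < pi / 2")
  case True
  have z: "z \<noteq> 0"
    using Im by auto
  then have sin: "sin (Arg z) = Im z / cmod z"
    by (rule sin_Arg)
  have pos: "sin (Arg z) > 0"
    unfolding sin using Im z by simp
  have "- (pi / 2) \<le> Arg z"
  proof (rule ccontr)
    assume "\<not> ?thesis"
    then have "sin (- Arg z) \<ge> 0"
      using Arg_bounded[of z] pi_gt_zero by (intro sin_ge_zero) linarith+
    with pos show False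
      by simp
  qed
  then have "Arg z = arcsin (sin (Arg z))"
    using True by (intro arcsin_sin[symmetric]) auto
  moreover have "s \<le> sin (Arg z)"
    unfolding sin using le z by (simp add: field_simps)
  then have "arcsin s \<le> arcsin (sin (Arg z))"
    using s by (intro arcsin_le_arcsin) auto
  ultimately show ?thesis
    by simp
next
  case False
  then show ?thesis
    using arcsin_bounded[of s] s by auto
qed

text \<open>For \<open>N = 2\<close> the non-negative multiple gains no degree, so it is a scalar
  multiple of \<open>p\<close>. Contrapositively, a negative coefficient yields a non-real root to
  which the angle estimates apply.\<close>

lemma nonneg_polys_if_roots_left_half_plane:
  fixes p :: "real poly"
  assumes lc: "lead_coeff p = 1"
    and pos: "\<And>x. x > 0 \<Longrightarrow> poly p x \<noteq> 0"
    and left: "\<And>z. poly (map_poly complex_of_real p) z = 0 \<Longrightarrow> Im z > 0 \<Longrightarrow> Re z \<le> 0"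
  shows "p \<in> nonneg_polys"
proof -
  have "pi \<le> real 2 * Arg z" if z: "poly (map_poly complex_of_real p) z = 0" "Im z > 0" for z
  proof (rule ccontr)
    assume less: "\<not> ?thesis"
    have nz: "z \<noteq> 0"
      using z(2) by auto
    have "Arg z \<ge> arcsin 0"
      using z(2) by (intro Arg_ge_arcsin) auto
    then have "cos (Arg z) > 0"
      using less by (intro cos_gt_zero_pi) auto
    then show False
      using left[OF z] nz by (simp add: cos_Arg zero_less_divide_iff)
  qed
  moreover have "p \<noteq> 0"
    using lc by auto
  ultimately obtain f where "f \<in> nonneg_polys" "f \<noteq> 0" "p dvd f" "degree f \<le> degree p"
    using nonneg_multiple_exists[of p 2] pos by auto
  then show ?thesis
    using nonneg_polys_of_nonneg_multiple[OF lc] by blast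
qed

text \<open>As \<open>n >= 2\<close>, \<open>n ^ (n + 2) / 3\<close> is at most
  \<open>n ^ (n + 3) / 4\<close>. The 4 leaves the square root as a factor 1/2, which cancels the 2
  in the distance 2 |y| of two conjugate roots.\<close>

lemma separation_imp_angle_bound:
  fixes D r y Q :: real
  assumes n: "n \<ge> 2" and D: "D \<ge> 0" and Q: "Q > 0"
    and sep: "r * D \<le> 2 * \<bar>y\<bar> * sqrt (real n ^ (n + 2) / 3) * Q"
  shows "1 / Q * sqrt (D\<^sup>2 / real n ^ (n + 3)) * r \<le> \<bar>y\<bar>"
proof -
  define T where "T = sqrt (real n ^ (n + 3))"
  have T: "T > 0"
    using n by (simp add: T_def)
  have "sqrt (real n ^ (n + 2) / 3) \<le> sqrt (real n ^ (n + 3) / 4)"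
    using n by (simp add: power_add power3_eq_cube power2_eq_square field_simps)
  also have "\<dots> = T / 2"
    by (simp add: T_def real_sqrt_divide)
  finally have "2 * \<bar>y\<bar> * sqrt (real n ^ (n + 2) / 3) * Q \<le> 2 * \<bar>y\<bar> * (T / 2) * Q"
    using Q by (intro mult_right_mono mult_left_mono) auto
  with sep have "r * D \<le> \<bar>y\<bar> * (T * Q)"
    by (simp add: mult_ac)
  moreover have "1 / Q * sqrt (D\<^sup>2 / real n ^ (n + 3)) * r = r * D / (T * Q)"
    using D by (simp add: T_def real_sqrt_divide mult_ac)
  ultimately show ?thesis
    using T Q by (simp add: pos_divide_le_eq)
qed

section \<open>The degree bound from the separation of conjugate roots\<close>

theorem corollary2p16:
  fixes p :: "real poly" and d :: nat and \<Delta> :: complex and M L K :: real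
  assumes "p \<in> pos_polys - nonneg_polys"
    and "lead_coeff p = 1"
    and "squarefree p"
    and "d = degree p"
    and "poly p 0 \<noteq> 0"
    and "\<Delta> = monic_discriminant (map_poly complex_of_real p)"
    and "M = mahler_measure_poly (map_poly complex_of_real p)"
    and "\<And>z. poly (map_poly complex_of_real p) z = 0 \<Longrightarrow> cmod z \<le> L"
    and "K \<in> {M, L powr (real d / 2)}"
  shows "ereal_of_enat (deg_plus p) \<le>
    ereal (real_of_int
      (\<lfloor>real d / 2\<rfloor> *
         (\<lceil>pi / arcsin (1 / K ^ (d - 1) * sqrt (cmod \<Delta> / real d ^ (d + 3)))\<rceil> - 2)
       + int d))"
proof -
  define P where "P = map_poly complex_of_real p"
  define a where "a i = complex_roots_complex P ! i" for i
  define D where "D = cmod (det (vandermonde_mat d a))"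
  define s where "s = 1 / K ^ (d - 1) * sqrt (cmod \<Delta> / real d ^ (d + 3))"
  define N where "N = nat \<lceil>pi / arcsin s\<rceil>"
  have p0: "p \<noteq> 0" and P0: "P \<noteq> 0"
    using assms(2) by (auto simp: P_def)
  have len: "length (complex_roots_complex P) = d" and degP: "degree P = d"
    by (simp_all add: P_def assms(4))
  have root_iff: "poly P z = 0 \<longleftrightarrow> z \<in> set (complex_roots_complex P)" for z
    by (rule poly_eq_0_iff_complex_roots[OF P0])
  have root_a: "poly P (a k) = 0" if "k < d" for k
    using that unfolding root_iff a_def len[symmetric] by (rule nth_mem)
  have root_index: "\<exists>k<d. a k = z" if "poly P z = 0" for z
    using that by (auto simp: root_iff a_def in_set_conv_nth degP)
  have pos: "poly p x \<noteq> 0" if "x > 0" for x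
    using that assms(1) p0 by (force simp: pos_polys_def)
  \<comment> \<open>The negative coefficient of \<open>p\<close> forces a non-real root, from which
    \<open>d >= 2\<close>, \<open>L > 0\<close> and later \<open>s <= 1\<close> follow.\<close>
  obtain w where w: "poly P w = 0" "Im w > 0"
    using nonneg_polys_if_roots_left_half_plane[OF assms(2) pos] assms(1) by (auto simp: P_def)
  have d2: "d \<ge> 2"
    using dvd_imp_degree_le[OF conj_quadratic_dvd[of p w]] w p0 by (simp add: P_def assms(4))
  have "distinct (complex_roots_complex P)"
    unfolding P_def by (rule distinct_complex_roots_of_squarefree[OF assms(3)])
  then have "D > 0"
    by (auto simp: D_def det_vandermonde_mat a_def nth_eq_iff_index_eq degP)
  have disc: "cmod \<Delta> = D\<^sup>2"
    by (simp add: assms(6) norm_monic_discriminant D_def a_def[abs_def] degP flip: P_def)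
  have lcP: "lead_coeff P = 1"
    using assms(2) by (simp add: P_def)
  have M: "M = (\<Prod>k<d. max 1 (cmod (a k)))"
    unfolding assms(7) mahler_measure_poly_def P_def[symmetric] lcP
    by (simp add: prod.list_conv_set_nth degP atLeast0LessThan a_def)
  have "L > 0"
  proof -
    have "0 < cmod w"
      using w(2) by auto
    also have "\<dots> \<le> L"
      using assms(8) w(1) by (simp add: P_def)
    finally show ?thesis .
  qed
  have "M \<ge> 1"
    unfolding M by (intro prod_ge_1) auto
  then have K: "K > 0"
    using assms(9) \<open>L > 0\<close> by auto
  have angle: "s * cmod z \<le> Im z" if z: "poly P z = 0" "Im z > 0" for z
  proof -
    have cnj: "poly P (cnj z) = 0"
      using z(1) by (simp add: P_def real_poly_cnj_root_iff)
    obtain i j where ij: "i < d" "a i = z" "j < d" "a j = cnj z"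
      using root_index[OF z(1)] root_index[OF cnj] by auto
    have neq: "a i \<noteq> a j"
      using z(2) ij by (simp add: complex_eq_iff)
    have "cmod z * D \<le> cmod (a i - a j) * sqrt (real d ^ (d + 2) / 3) * K ^ (d - 1)"
    proof (cases "K = M")
      case True
      then show ?thesis
        unfolding D_def True M using ij neq by (intro vandermonde_root_separation) auto
    next
      case False
      then have KL: "K = L powr (real d / 2)"
        using assms(9) by auto
      have "cmod (a k) \<le> L" if "k < d" for k
        using assms(8) root_a[OF that] by (simp add: P_def)
      then show ?thesis
        unfolding D_def KL using ij neq \<open>L > 0\<close>
        by (intro vandermonde_root_separation_bounded) auto
    qed
    moreover have "cmod (a i - a j) = 2 * \<bar>Im z\<bar>"
      by (simp add: ij complex_diff_cnj norm_mult)
    ultimately have "s * cmod z \<le> \<bar>Im z\<bar>"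
      unfolding s_def disc using \<open>D > 0\<close> K d2 by (intro separation_imp_angle_bound) auto
    with z(2) show ?thesis
      by simp
  qed
  have "s > 0"
    using K \<open>D > 0\<close> d2 by (simp add: s_def disc)
  \<comment> \<open>The angle bound at \<open>w\<close> puts \<open>s\<close> into the domain of
    arcsine.\<close>
  have "s * cmod w \<le> cmod w"
    using angle[OF w] abs_Im_le_cmod[of w] by linarith
  moreover have "cmod w > 0"
    using w(2) by auto
  ultimately have "s \<le> 1"
    by simp
  have arcsin: "0 < arcsin s" "arcsin s \<le> pi / 2"
    using \<open>s > 0\<close> \<open>s \<le> 1\<close> arcsin_less_arcsin[of 0 s] arcsin_bounded[of s] by auto
  then have "2 \<le> pi / arcsin s"
    by (simp add: field_simps)
  \<comment> \<open>This makes the truncated difference \<open>N - 2\<close> agree with the integer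
    difference in the claim.\<close>
  then have N2: "N \<ge> 2" and ceil: "\<lceil>pi / arcsin s\<rceil> = int N"
    unfolding N_def by linarith+
  have "pi / arcsin s \<le> real N"
    using ceil by linarith
  then have "pi \<le> real N * arcsin s"
    using arcsin(1) by (simp add: field_simps)
  then have "pi \<le> real N * Arg z" if "poly P z = 0" "Im z > 0" for z
    using Arg_ge_arcsin[OF that(2) _ \<open>s \<le> 1\<close> angle[OF that]] \<open>s > 0\<close>
      mult_left_mono[of "arcsin s" "Arg z" "real N"] by simp
  then obtain f where f: "f \<in> nonneg_polys" "f \<noteq> 0" "p dvd f" "degree f \<le> d + d div 2 * (N - 2)"
    using nonneg_multiple_exists[OF p0 N2 pos] unfolding P_def assms(4) by blast
  have floor: "\<lfloor>real d / 2\<rfloor> = int (d div 2)"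
    using floor_divide_of_nat_eq[of d 2] by simp
  have "int (degree f) \<le> int (d + d div 2 * (N - 2))"
    using f(4) by (simp only: of_nat_le_iff)
  also have "\<dots> = \<lfloor>real d / 2\<rfloor> * (\<lceil>pi / arcsin s\<rceil> - 2) + int d"
    using N2 by (simp add: floor ceil of_nat_diff)
  finally have "real_of_int (int (degree f)) \<le>
      real_of_int (\<lfloor>real d / 2\<rfloor> * (\<lceil>pi / arcsin s\<rceil> - 2) + int d)"
    by (simp only: of_int_le_iff)
  moreover have "deg_plus p \<le> enat (degree f)"
    unfolding deg_plus_def using f by (intro INF_lower) auto
  then have "ereal_of_enat (deg_plus p) \<le> ereal (real_of_int (int (degree f)))"
    by (metis ereal_of_enat_le_iff ereal_of_enat_simps(1) of_int_of_nat_eq)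
  ultimately show ?thesis
    unfolding s_def[symmetric] by (meson ereal_less_eq(3) order_trans)
qed

end
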